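(* Any fractal measure $\mu$ on $\mathbb{R}^d$ obtained from an affine iterated function system has an infinite discrete $(p,q)$-Bessel measure $\nu$, where $1\le p\le 2$ and $q$ is the conjugate exponent to $p$.
   Context: An iterated function system (IFS) is a finite set $\{\tau_i\}_{i=1}^n$ of contraction mappings on a complete metric space, here $\mathbb{R}^d$. It has a unique compact attractor $X$ with $X=\bigcup_{i=1}^n\tau_i(X)$. If it is associated with probability weights $\{\rho_i\}_{i=1}^n$ ($0<\rho_i<1$, $\sum_i\rho_i=1$), there is a unique Borel probability measure $\mu$ supported on $X$ with $\mu=\sum_{i=1}^n\rho_i(\mu\circ\tau_i^{-1})$, called the invariant measure of the IFS. This is the measure obtained from the IFS. In an affine IFS each $\tau_i$ is affine and represented by a matrix. For example, if $R$ is a $d\times d$ expanding integer matrix (all eigenvalues $\lambda$ satisfy $|\lambda|>1$) and $\mathcal{A}\subset\mathbb{Z}^d$ is finite with $\#\mathcal{A}\ge2$, then the maps $\tau_a(x)=R^{-1}(x+a)$ ($x\in\mathbb{R}^d$, $a\in\mathcal{A}$), with a set of probability weights, form an affine IFS. In some cases the invariant measure is a fractal measure; for example, singular continuous invariant measures supported on Cantor type sets are fractal measures. The term "fractal measure" is used in this sense, with no further formal definition. For $t\in\mathbb{R}^d$ let $e_t(x)=e^{2\pi i t\cdot x}$. For a Borel probability measure $\mu$ on $\mathbb{R}^d$, $1\le p<\infty$, $f\in L^p(\mu)$ and $t\in\mathbb{R}^d$, put $\widehat{f d\mu}(t)=\int f(x)e^{-2\pi i t\cdot x}\,d\mu(x)$.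 The compatible semi-inner product on $L^p(\mu)$ is $[f,g]_{L^p(\mu)}=\|g\|_{L^p(\mu)}^{2-p}\int f|g|^{p-1}\overline{\mathrm{sgn}(g)}\,d\mu$ for $\|g\|_{L^p(\mu)}\ne0$, and $0$ otherwise; it satisfies $[f,e_t]_{L^p(\mu)}=\widehat{f d\mu}(t)$. For conjugate exponents $1<p,q<\infty$, $\frac1p+\frac1q=1$, a Borel measure $\nu$ on $\mathbb{R}^d$ is a $(p,q)$-Bessel measure for $\mu$ if there is $B>0$ with $\int_{\mathbb{R}^d}|[f,e_t]_{L^p(\mu)}|^q\,d\nu(t)\le B\|f\|_{L^p(\mu)}^q$ for all $f\in L^p(\mu)$. For $p=1$, $q=\infty$, the condition is $\|\widehat{f d\mu}\|_\infty\le B\|f\|_{L^1(\mu)}$ for all $f\in L^1(\mu)$, where $\|\cdot\|_\infty$ is the norm of $L^\infty(\nu)$. A discrete measure is one of the form $\sum_{\lambda\in\Lambda}c_\lambda\delta_\lambda$ with $\Lambda\subset\mathbb{R}^d$ countable, $c_\lambda>0$ and $\delta_\lambda$ the Dirac measure at $\lambda$; it is infinite if its total mass is $\infty$. *)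

theory Defs
  imports "HOL-Probability.Probability"
begin

section \<open>Iterated function systems\<close>

definition contraction_wrt :: "('a \<Rightarrow> 'a \<Rightarrow> real) \<Rightarrow> ('a \<Rightarrow> 'a) \<Rightarrow> bool" where
  "contraction_wrt D \<tau> \<longleftrightarrow> (\<exists>c. 0 \<le> c \<and> c < 1 \<and> (\<forall>x y. D (\<tau> x) (\<tau> y) \<le> c * D x y))"

text \<open>
  The maps are contractions for a common complete metric that induces the usual topology, not
  necessarily the Euclidean one: for an expanding integer matrix \<open>R\<close>, the maps
  \<open>x \<mapsto> R\<^sup>-\<^sup>1 (x + a)\<close> are in general contractions only for a norm adapted to \<open>R\<close>.
\<close>

definition ifs :: "nat \<Rightarrow> (nat \<Rightarrow> real^'d \<Rightarrow> real^'d) \<Rightarrow> bool" where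
  "ifs n \<tau> \<longleftrightarrow>
     (\<exists>D. Metric_space UNIV D \<and> Metric_space.mcomplete UNIV D \<and>
          Metric_space.mtopology UNIV D = euclidean \<and>
          (\<forall>i\<in>{1..n}. contraction_wrt D (\<tau> i)))"

definition affine_ifs :: "nat \<Rightarrow> (nat \<Rightarrow> real^'d \<Rightarrow> real^'d) \<Rightarrow> bool" where
  "affine_ifs n \<tau> \<longleftrightarrow>
     ifs n \<tau> \<and> (\<forall>i\<in>{1..n}. \<exists>(A :: real^'d^'d) b. \<forall>x. \<tau> i x = A *v x + b)"

definition probability_weights :: "nat \<Rightarrow> (nat \<Rightarrow> real) \<Rightarrow> bool" where
  "probability_weights n \<rho> \<longleftrightarrow> (\<forall>i\<in>{1..n}. 0 < \<rho> i \<and> \<rho> i < 1) \<and> (\<Sum>i=1..n. \<rho> i) = 1"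

definition attractor :: "nat \<Rightarrow> (nat \<Rightarrow> real^'d \<Rightarrow> real^'d) \<Rightarrow> (real^'d) set \<Rightarrow> bool" where
  "attractor n \<tau> X \<longleftrightarrow> compact X \<and> X \<noteq> {} \<and> X = (\<Union>i\<in>{1..n}. \<tau> i ` X)"

definition invariant_measure ::
  "nat \<Rightarrow> (nat \<Rightarrow> real^'d \<Rightarrow> real^'d) \<Rightarrow> (nat \<Rightarrow> real) \<Rightarrow> (real^'d) measure \<Rightarrow> bool" where
  "invariant_measure n \<tau> \<rho> \<mu> \<longleftrightarrow>
     prob_space \<mu> \<and> sets \<mu> = sets borel \<and>
     (\<exists>X. attractor n \<tau> X \<and> emeasure \<mu> (- X) = 0) \<and>
     (\<forall>A\<in>sets borel. measure \<mu> A = (\<Sum>i=1..n. \<rho> i * measure \<mu> (\<tau> i -` A)))"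

text \<open>
  "Fractal measure" is an informal term, whose typical instances are singular continuous
  invariant measures on Cantor type sets.  Of this only continuity (absence of point masses) is
  demanded, so that every such instance is covered.  Continuity cannot be dropped: if
  \<open>\<mu> {x} > 0\<close> then testing with the indicator function of \<open>{x}\<close> shows that for \<open>p > 1\<close> every
  \<open>(p,q)\<close>-Bessel measure is finite, and invariant measures with atoms do exist (for instance the
  point mass at a common fixed point of all the maps).
\<close>

definition fractal_measure ::
  "nat \<Rightarrow> (nat \<Rightarrow> real^'d \<Rightarrow> real^'d) \<Rightarrow> (nat \<Rightarrow> real) \<Rightarrow> (real^'d) measure \<Rightarrow> bool" where
  "fractal_measure n \<tau> \<rho> \<mu> \<longleftrightarrow> invariant_measure n \<tau> \<rho> \<mu> \<and> (\<forall>x. emeasure \<mu> {x} = 0)"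


section \<open>The semi-inner product on \<open>L\<^sup>p(\<mu>)\<close>\<close>

definition Lp_space :: "real \<Rightarrow> 'a measure \<Rightarrow> ('a \<Rightarrow> complex) set" where
  "Lp_space p \<mu> = {f \<in> borel_measurable \<mu>. integrable \<mu> (\<lambda>x. cmod (f x) powr p)}"

definition Lp_norm :: "real \<Rightarrow> 'a measure \<Rightarrow> ('a \<Rightarrow> complex) \<Rightarrow> real" where
  "Lp_norm p \<mu> f = (\<integral>x. cmod (f x) powr p \<partial>\<mu>) powr (1 / p)"

definition semi_inner :: "real \<Rightarrow> 'a measure \<Rightarrow> ('a \<Rightarrow> complex) \<Rightarrow> ('a \<Rightarrow> complex) \<Rightarrow> complex" where
  "semi_inner p \<mu> f g =
     (if Lp_norm p \<mu> g = 0 then 0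
      else of_real (Lp_norm p \<mu> g powr (2 - p)) *
           (\<integral>x. f x * of_real (cmod (g x) powr (p - 1)) * cnj (sgn (g x)) \<partial>\<mu>))"

definition expo :: "real^'d \<Rightarrow> real^'d \<Rightarrow> complex" where
  "expo t x = exp (2 * of_real pi * \<i> * of_real (t \<bullet> x))"

definition fourier :: "(real^'d) measure \<Rightarrow> (real^'d \<Rightarrow> complex) \<Rightarrow> real^'d \<Rightarrow> complex" where
  "fourier \<mu> f t = (\<integral>x. f x * exp (- 2 * of_real pi * \<i> * of_real (t \<bullet> x)) \<partial>\<mu>)"


section \<open>Bessel measures\<close>

text \<open>
  The exponent \<open>q\<close> is an extended number, \<open>q = \<infinity>\<close> being the conjugate of \<open>p = 1\<close>.  The function
  under \<open>esssup\<close> is continuous, so \<open>esssup\<close> is the norm of \<open>L\<^sup>\<infinity>(\<nu>)\<close> there.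
\<close>

definition bessel_measure ::
  "real \<Rightarrow> ennreal \<Rightarrow> (real^'d) measure \<Rightarrow> (real^'d) measure \<Rightarrow> bool" where
  "bessel_measure p q \<mu> \<nu> \<longleftrightarrow>
     sets \<nu> = sets borel \<and>
     (\<exists>B::real. 0 < B \<and>
        (\<forall>f\<in>Lp_space p \<mu>.
           if q = \<infinity>
           then esssup \<nu> (\<lambda>t. ennreal (cmod (fourier \<mu> f t))) \<le> ennreal (B * Lp_norm p \<mu> f)
           else (\<integral>\<^sup>+t. ennreal (cmod (semi_inner p \<mu> f (expo t)) powr enn2real q) \<partial>\<nu>)
                  \<le> ennreal (B * Lp_norm p \<mu> f powr enn2real q)))"

definition discrete_measure :: "(real^'d) measure \<Rightarrow> bool" where
  "discrete_measure \<nu> \<longleftrightarrow>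
     sets \<nu> = sets borel \<and>
     (\<exists>\<Lambda> (c :: real^'d \<Rightarrow> real). countable \<Lambda> \<and> (\<forall>s\<in>\<Lambda>. 0 < c s) \<and>
        (\<forall>A\<in>sets borel.
           emeasure \<nu> A = (\<integral>\<^sup>+s. ennreal (c s) * emeasure (return borel s) A \<partial>count_space \<Lambda>)))"

end

theory Submission
  imports Defs
begin

text \<open>
  The Bessel measure is carried by the multiples \<open>k u\<close> (\<open>k = 0, 1, 2, \<dots>\<close>) of one vector \<open>u\<close>, and
  the source of the estimate is that a continuous measure \<open>\<mu>\<close> has Fourier coefficients that are
  small on average along such a progression, uniformly over the unit ball of \<open>L\<^sup>p(\<mu>)\<close>.

  Let \<open>1 < p \<le> 2\<close> and let \<open>K\<^sub>N(z)\<close> be the mean of \<open>exp(-2\<pi>i k u\<cdot>z)\<close> over \<open>k < N\<close>.  By Fubini,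
  the mean of \<open>\<bar>[f, e\<^bsub>ku\<^esub>]\<bar>\<^sup>2\<close> over \<open>k < N\<close> is the integral of
  \<open>f(x) cnj(f(y)) K\<^sub>N(x - y)\<close> against \<open>\<mu> \<times> \<mu>\<close>, which Hoelder's inequality on the product space
  bounds by \<open>\<parallel>f\<parallel>\<^sub>p\<^sup>2 \<epsilon>\<^sub>N\<close>, where \<open>\<epsilon>\<^sub>N\<close> is the norm of \<open>(x,y) \<mapsto> K\<^sub>N(x - y)\<close> in
  \<open>L\<^sup>q(\<mu> \<times> \<mu>)\<close> (\<open>mean_square_fourier_le\<close>).  Since \<open>q \<ge> 2\<close> and every coefficient is at most
  \<open>\<parallel>f\<parallel>\<^sub>p\<close>, the mean of the \<open>q\<close>-th powers is at most \<open>\<parallel>f\<parallel>\<^sub>p\<^sup>q \<epsilon>\<^sub>N\<close>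
  (\<open>mean_fourier_powr_le\<close>).  This is the one place where \<open>p \<le> 2\<close> enters, and it gives all these
  exponents at once, without interpolation between \<open>p = 1\<close> and \<open>p = 2\<close>.

  The sum in \<open>K\<^sub>N(z)\<close> is geometric, so \<open>K\<^sub>N(z) \<rightarrow> 0\<close> unless \<open>u\<cdot>z\<close> is an integer.  As \<open>\<mu>\<close> has no
  atoms, the diagonal is a null set for \<open>\<mu> \<times> \<mu>\<close>, and for almost every \<open>u\<close> the number
  \<open>u\<cdot>(x - y)\<close> is not an integer for almost all \<open>(x,y)\<close>
  (\<open>exists_nonresonant_direction\<close>).  For such a \<open>u\<close>, dominated convergence gives
  \<open>\<epsilon>\<^sub>N \<rightarrow> 0\<close>.

  Choose \<open>N\<^sub>0, N\<^sub>1, \<dots>\<close> with \<open>\<epsilon>\<close> at \<open>N\<^sub>m\<close> at most \<open>2\<^sup>-\<^sup>m\<close>, and let \<open>\<nu>\<close> be the sum over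
  \<open>m\<close> of the uniform distributions on \<open>{k u | k < N\<^sub>m}\<close>.  Each summand has mass one, so \<open>\<nu>\<close> is
  infinite, while the Bessel sum is at most \<open>\<Sum>\<^sub>m 2\<^sup>-\<^sup>m \<parallel>f\<parallel>\<^sub>p\<^sup>q = 2 \<parallel>f\<parallel>\<^sub>p\<^sup>q\<close>
  (\<open>divergent_weights\<close>).

  For \<open>p = 1\<close> every measure \<open>\<nu>\<close> will do, because \<open>\<bar>[f, e\<^sub>t]\<bar> \<le> \<parallel>f\<parallel>\<^sub>1\<close> for all \<open>t\<close>.
\<close>

section \<open>Hoelder's inequality\<close>

lemma Lp_norm_nonneg [simp]: "0 \<le> Lp_norm p M f"
  by (simp add: Lp_norm_def)

lemma Lp_norm_powr: "p \<noteq> 0 \<Longrightarrow> Lp_norm p M f powr p = (\<integral>x. cmod (f x) powr p \<partial>M)"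
  by (simp add: Lp_norm_def powr_powr)

text \<open>
  Young's inequality, applied to \<open>f\<close> and \<open>g\<close> divided by their norms and then integrated.
\<close>

lemma Hoelder_inequality:
  fixes f g :: "'a \<Rightarrow> complex"
  assumes p: "1 < p" and q: "1 < q" and pq: "1 / p + 1 / q = 1"
    and f: "f \<in> Lp_space p M" and g: "g \<in> Lp_space q M"
  shows "integrable M (\<lambda>x. f x * g x)"
    and "cmod (\<integral>x. f x * g x \<partial>M) \<le> Lp_norm p M f * Lp_norm q M g"
proof -
  have [measurable]: "f \<in> borel_measurable M" "g \<in> borel_measurable M"
    and fi: "integrable M (\<lambda>x. cmod (f x) powr p)" and gi: "integrable M (\<lambda>x. cmod (g x) powr q)"
    using f g by (auto simp: Lp_space_def)
  have young: "cmod (f x * g x) \<le> cmod (f x) powr p / p + cmod (g x) powr q / q" for x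
    using Youngs_inequality[OF p q pq, of "cmod (f x)" "cmod (g x)"] by (simp add: norm_mult)
  show int: "integrable M (\<lambda>x. f x * g x)"
  proof (rule Bochner_Integration.integrable_bound)
    show "integrable M (\<lambda>x. cmod (f x) powr p / p + cmod (g x) powr q / q)"
      using fi gi by simp
    show "AE x in M. cmod (f x * g x) \<le> norm (cmod (f x) powr p / p + cmod (g x) powr q / q)"
      using order_trans[OF young abs_ge_self] by simp
  qed measurable
  define A B where "A = Lp_norm p M f" and "B = Lp_norm q M g"
  have vanish: "(\<integral>x. f x * g x \<partial>M) = 0" if "AE x in M. f x = 0 \<or> g x = 0"
  proof -
    have "(\<integral>x. f x * g x \<partial>M) = (\<integral>x. 0 \<partial>M)"
      by (rule integral_cong_AE) (use that in auto)
    then show ?thesis by simp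
  qed
  show "cmod (\<integral>x. f x * g x \<partial>M) \<le> Lp_norm p M f * Lp_norm q M g"
  proof (cases "A = 0 \<or> B = 0")
    case True
    have "AE x in M. f x = 0 \<or> g x = 0"
      using True
    proof
      assume "A = 0"
      then have "(\<integral>x. cmod (f x) powr p \<partial>M) = 0"
        using Lp_norm_powr[of p M f] p by (simp add: A_def)
      then show ?thesis
        by (subst (asm) integral_nonneg_eq_0_iff_AE[OF fi]) (auto elim: eventually_mono)
    next
      assume "B = 0"
      then have "(\<integral>x. cmod (g x) powr q \<partial>M) = 0"
        using Lp_norm_powr[of q M g] q by (simp add: B_def)
      then show ?thesis
        by (subst (asm) integral_nonneg_eq_0_iff_AE[OF gi]) (auto elim: eventually_mono)
    qed
    then show ?thesis
      by (simp add: vanish)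
  next
    case False
    then have pos: "0 < A" "0 < B"
      using Lp_norm_nonneg[of p M f] Lp_norm_nonneg[of q M g] unfolding A_def B_def by linarith+
    have Ap: "(\<integral>x. cmod (f x) powr p \<partial>M) = A powr p" and Bq: "(\<integral>x. cmod (g x) powr q \<partial>M) = B powr q"
      using p q by (simp_all add: A_def B_def Lp_norm_powr)
    have "cmod (\<integral>x. f x * g x \<partial>M) \<le> (\<integral>x. cmod (f x * g x) \<partial>M)"
      by simp
    also have "\<dots> \<le> (\<integral>x. A * B * (cmod (f x) powr p / (A powr p * p) + cmod (g x) powr q / (B powr q * q)) \<partial>M)"
    proof (rule integral_mono)
      fix x
      have "cmod (f x) / A * (cmod (g x) / B) \<le> (cmod (f x) / A) powr p / p + (cmod (g x) / B) powr q / q"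
        using pos by (intro Youngs_inequality[OF p q pq]) auto
      then have "A * B * (cmod (f x) / A * (cmod (g x) / B))
          \<le> A * B * ((cmod (f x) / A) powr p / p + (cmod (g x) / B) powr q / q)"
        using pos by (intro mult_left_mono) auto
      then show "cmod (f x * g x)
          \<le> A * B * (cmod (f x) powr p / (A powr p * p) + cmod (g x) powr q / (B powr q * q))"
        using pos by (simp add: norm_mult powr_divide)
    qed (use int fi gi in auto)
    also have "\<dots> = A * B * (1 / p + 1 / q)"
      using fi gi pos by (simp add: Ap Bq)
    finally show ?thesis
      by (simp add: pq A_def B_def)
  qed
qed

section \<open>Fourier coefficients of functions in \<open>L\<^sup>p(\<mu>)\<close>\<close>

lemma Lp_space_integrable:
  assumes "finite_measure M" "1 \<le> p" "f \<in> Lp_space p M"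
  shows "integrable M f"
proof -
  interpret finite_measure M by fact
  have f: "f \<in> borel_measurable M" "integrable M (\<lambda>x. cmod (f x) powr p)"
    using assms by (auto simp: Lp_space_def)
  have "norm (f x) \<le> norm (1 + cmod (f x) powr p)" for x
  proof (cases "cmod (f x) \<le> 1")
    case False
    then have "cmod (f x) powr 1 \<le> cmod (f x) powr p"
      using assms by (intro powr_mono) auto
    then show ?thesis using False by simp
  qed (simp add: add_increasing2)
  then show ?thesis
    using f by (intro Bochner_Integration.integrable_bound[of M "\<lambda>x. 1 + cmod (f x) powr p" f] AE_I2)
      simp_all
qed

text \<open>
  The integral kernel of \<open>fourier\<close>, that is, the complex conjugate of \<open>expo\<close>.
\<close>

definition wave :: "real^'d \<Rightarrow> real^'d \<Rightarrow> complex" where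
  "wave t x = exp (- 2 * of_real pi * \<i> * of_real (t \<bullet> x))"

lemma fourier_wave: "fourier \<mu> f t = (\<integral>x. f x * wave t x \<partial>\<mu>)"
  by (simp add: fourier_def wave_def)

lemma wave_cis: "wave t x = cis (- 2 * pi * (t \<bullet> x))"
  by (simp add: wave_def cis_conv_exp mult_ac)

lemma norm_wave [simp]: "cmod (wave t x) = 1"
  by (simp add: wave_cis)

lemma wave_measurable [measurable]:
  "wave t \<in> borel_measurable borel"
  unfolding wave_def by measurable

lemma fourier_measurable:
  assumes "prob_space \<mu>" and [measurable_cong]: "sets \<mu> = sets borel"
    and [measurable]: "f \<in> borel_measurable \<mu>"
  shows "fourier \<mu> f \<in> borel_measurable borel"
proof -
  interpret prob_space \<mu> by fact
  show ?thesis
    unfolding fourier_wave[abs_def] wave_def by measurable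
qed

lemma norm_expo [simp]: "cmod (expo t x) = 1"
  by (simp add: expo_def norm_exp_eq_Re)

lemma cnj_sgn_expo: "cnj (sgn (expo t x)) = wave t x"
proof -
  have "expo t x = cis (2 * pi * (t \<bullet> x))"
    by (simp add: expo_def cis_conv_exp mult_ac)
  then show ?thesis
    by (simp add: sgn_eq wave_cis cis_cnj)
qed

lemma semi_inner_expo:
  assumes "prob_space \<mu>"
  shows "semi_inner p \<mu> f (expo t) = fourier \<mu> f t"
proof -
  interpret prob_space \<mu> by fact
  have "Lp_norm p \<mu> (expo t) = 1"
    by (simp add: Lp_norm_def prob_space)
  then show ?thesis
    by (simp add: semi_inner_def cnj_sgn_expo fourier_wave)
qed

lemma fourier_le_L1:
  assumes "prob_space \<mu>"
  shows "cmod (fourier \<mu> f t) \<le> Lp_norm 1 \<mu> f"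
proof -
  have "cmod (fourier \<mu> f t) \<le> (\<integral>x. cmod (f x * wave t x) \<partial>\<mu>)"
    unfolding fourier_wave by (rule integral_norm_bound)
  also have "\<dots> = Lp_norm 1 \<mu> f"
    by (simp add: Lp_norm_def norm_mult)
  finally show ?thesis .
qed

lemma fourier_le_Lp:
  assumes "prob_space \<mu>" and [measurable_cong]: "sets \<mu> = sets borel"
    and "1 < p" "1 < q" "1 / p + 1 / q = 1" "f \<in> Lp_space p \<mu>"
  shows "cmod (fourier \<mu> f t) \<le> Lp_norm p \<mu> f"
proof -
  interpret prob_space \<mu> by fact
  have [measurable]: "wave t \<in> borel_measurable \<mu>"
    by measurable
  have "wave t \<in> Lp_space q \<mu>"
    by (simp add: Lp_space_def)
  from Hoelder_inequality(2)[OF assms(3-6) this] show ?thesis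
    by (simp add: fourier_wave Lp_norm_def[of q] prob_space)
qed

section \<open>Averages of Fourier coefficients along an arithmetic progression\<close>

definition mean_wave :: "real^'d \<Rightarrow> nat \<Rightarrow> real^'d \<Rightarrow> complex" where
  "mean_wave u N z = (\<Sum>k<N. wave (real k *\<^sub>R u) z) / of_nat N"

lemma norm_mean_wave_le: "cmod (mean_wave u N z) \<le> 1"
proof -
  have "cmod (\<Sum>k<N. wave (real k *\<^sub>R u) z) \<le> (\<Sum>k<N. cmod (wave (real k *\<^sub>R u) z))"
    by (rule norm_sum)
  then show ?thesis
    by (cases "N = 0") (auto simp: mean_wave_def norm_divide)
qed

lemma mean_wave_measurable [measurable]: "mean_wave u N \<in> borel_measurable borel"
  unfolding mean_wave_def by measurable

text \<open>
  A sum of powers of \<open>w = exp(-2\<pi>i u\<cdot>z) \<noteq> 1\<close> stays bounded by \<open>2 / \<bar>w - 1\<bar>\<close>, whatever its length.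
\<close>

lemma mean_wave_tendsto_0:
  assumes "u \<bullet> z \<notin> \<int>"
  shows "(\<lambda>N. mean_wave u N z) \<longlonglongrightarrow> 0"
proof -
  define w where "w = cis (- 2 * pi * (u \<bullet> z))"
  have "w \<noteq> 1"
  proof
    assume "w = 1"
    then obtain k :: int where "- 2 * pi * (u \<bullet> z) = of_int (2 * k) * pi"
      by (auto simp: w_def cis_conv_exp exp_eq_1)
    then have "pi * - (u \<bullet> z) = pi * of_int k"
      by (simp add: mult_ac)
    then have "- (u \<bullet> z) = of_int k"
      unfolding mult_left_cancel[OF pi_neq_zero] .
    then have "u \<bullet> z = of_int (- k)"
      by simp
    then have "u \<bullet> z \<in> \<int>"
      by (metis Ints_of_int)
    with assms show False by simp
  qed
  have w: "wave (real k *\<^sub>R u) z = w ^ k" for k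
    by (simp add: w_def wave_cis Complex.DeMoivre mult_ac)
  have "cmod (mean_wave u N z) \<le> 2 / cmod (w - 1) / real N" for N
  proof -
    have "mean_wave u N z = (w ^ N - 1) / (w - 1) / of_nat N"
      using \<open>w \<noteq> 1\<close> by (simp add: mean_wave_def w geometric_sum)
    moreover have "cmod (w ^ N - 1) \<le> 2"
      using norm_triangle_ineq4[of "w ^ N" 1] by (simp add: w_def norm_power)
    ultimately show ?thesis
      by (simp only: norm_divide) (auto intro!: divide_right_mono)
  qed
  moreover have "(\<lambda>N. 2 / cmod (w - 1) / real N) \<longlonglongrightarrow> 0"
    by (rule lim_const_over_n)
  ultimately show ?thesis
    by (rule Lim_null_comparison[OF always_eventually, rule_format])
qed

text \<open>
  For a fixed \<open>v \<noteq> 0\<close> the vectors \<open>u\<close> with \<open>u\<cdot>v \<in> \<int>\<close> fill countably many hyperplanes, a Lebesgue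
  null set.  As \<open>\<mu>\<close> has no atoms, \<open>v = x - y\<close> is nonzero almost everywhere, and Fubini's theorem
  interchanges the two quantifiers "for almost all \<open>(x,y)\<close>" and "for almost all \<open>u\<close>".
\<close>

lemma exists_nonresonant_direction:
  fixes \<mu> :: "(real^'d) measure"
  assumes "prob_space \<mu>" and [measurable_cong]: "sets \<mu> = sets borel"
    and atomless: "\<And>x. emeasure \<mu> {x} = 0"
  shows "\<exists>u. AE z in \<mu> \<Otimes>\<^sub>M \<mu>. u \<bullet> (fst z - snd z) \<notin> \<int>"
proof -
  interpret prob_space \<mu> by fact
  interpret P: pair_prob_space \<mu> \<mu> ..
  interpret Q: pair_sigma_finite "\<mu> \<Otimes>\<^sub>M \<mu>" "lborel :: (real^'d) measure" ..
  have [measurable]: "(\<int> :: real set) \<in> sets borel"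
    by (simp add: closed_Ints borel_closed)
  have meas: "{z \<in> space ((\<mu> \<Otimes>\<^sub>M \<mu>) \<Otimes>\<^sub>M (lborel :: (real^'d) measure)).
      snd z \<bullet> (fst (fst z) - snd (fst z)) \<notin> \<int>} \<in> sets ((\<mu> \<Otimes>\<^sub>M \<mu>) \<Otimes>\<^sub>M lborel)"
    by measurable
  have off: "AE z in \<mu> \<Otimes>\<^sub>M \<mu>. fst z \<noteq> snd z"
  proof (rule P.AE_pair_measure)
    show "{z \<in> space (\<mu> \<Otimes>\<^sub>M \<mu>). fst z \<noteq> snd z} \<in> sets (\<mu> \<Otimes>\<^sub>M \<mu>)"
      by measurable
    show "AE x in \<mu>. AE y in \<mu>. fst (x, y) \<noteq> snd (x, y)"
    proof (rule AE_I2)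
      fix x
      have "AE y in \<mu>. y \<notin> {x}"
        by (rule AE_discrete_difference) (auto simp: atomless assms(2))
      then show "AE y in \<mu>. fst (x, y) \<noteq> snd (x, y)"
        by (auto elim: eventually_mono)
    qed
  qed
  have null: "AE u in lborel. u \<bullet> v \<notin> \<int>" if "v \<noteq> 0" for v :: "real^'d"
  proof -
    have "AE u in lborel. \<forall>k::int. u \<bullet> v \<noteq> of_int k"
      unfolding AE_all_countable
    proof
      fix k :: int
      have "negligible {u. v \<bullet> u = of_int k}"
        using that by (intro negligible_hyperplane) auto
      then have "AE u in lebesgue. u \<notin> {u. v \<bullet> u = of_int k}"
        unfolding negligible_iff_null_sets by (rule AE_not_in)
      then show "AE u in lborel. u \<bullet> v \<noteq> of_int k"
        by (simp add: AE_completion_iff inner_commute)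
    qed
    then show ?thesis
      by (auto elim!: eventually_mono Ints_cases)
  qed
  have "AE z in \<mu> \<Otimes>\<^sub>M \<mu>. AE u in lborel. u \<bullet> (fst z - snd z) \<notin> \<int>"
    using off by (auto elim!: eventually_mono intro!: null)
  then have "AE u in lborel. AE z in \<mu> \<Otimes>\<^sub>M \<mu>. u \<bullet> (fst z - snd z) \<notin> \<int>"
    using Q.AE_commute[OF meas] by simp
  moreover have "ae_filter (lborel :: (real^'d) measure) \<noteq> bot"
    by (simp add: ae_filter_eq_bot_iff)
  ultimately show ?thesis
    using eventually_happens' by blast
qed

lemma Lp_norm_mean_wave_tendsto_0:
  fixes \<mu> :: "(real^'d) measure"
  assumes "prob_space \<mu>" and [measurable_cong]: "sets \<mu> = sets borel"
    and u: "AE z in \<mu> \<Otimes>\<^sub>M \<mu>. u \<bullet> (fst z - snd z) \<notin> \<int>" and q: "0 < q"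
  shows "(\<lambda>N. Lp_norm q (\<mu> \<Otimes>\<^sub>M \<mu>) (\<lambda>z. mean_wave u N (fst z - snd z))) \<longlonglongrightarrow> 0"
proof -
  interpret prob_space \<mu> by fact
  interpret P: pair_prob_space \<mu> \<mu> ..
  have "(\<lambda>N. \<integral>z. cmod (mean_wave u N (fst z - snd z)) powr q \<partial>(\<mu> \<Otimes>\<^sub>M \<mu>))
      \<longlonglongrightarrow> (\<integral>z. 0 \<partial>(\<mu> \<Otimes>\<^sub>M \<mu>))"
  proof (rule integral_dominated_convergence[where w = "\<lambda>_. 1"])
    show "AE z in \<mu> \<Otimes>\<^sub>M \<mu>. (\<lambda>N. cmod (mean_wave u N (fst z - snd z)) powr q) \<longlonglongrightarrow> 0"
      using u
    proof (rule eventually_mono)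
      fix z assume "u \<bullet> (fst z - snd z) \<notin> \<int>"
      then have "(\<lambda>N. mean_wave u N (fst z - snd z)) \<longlonglongrightarrow> 0"
        by (rule mean_wave_tendsto_0)
      then have "(\<lambda>N. cmod (mean_wave u N (fst z - snd z)) powr q) \<longlonglongrightarrow> 0 powr q"
        using q by (intro tendsto_powr' tendsto_norm_zero) auto
      then show "(\<lambda>N. cmod (mean_wave u N (fst z - snd z)) powr q) \<longlonglongrightarrow> 0"
        using q by simp
    qed
    show "AE z in \<mu> \<Otimes>\<^sub>M \<mu>. norm (cmod (mean_wave u N (fst z - snd z)) powr q) \<le> 1" for N
      using q by (intro AE_I2) (auto intro!: powr_le1 norm_mean_wave_le)
  qed auto
  then have "(\<lambda>N. Lp_norm q (\<mu> \<Otimes>\<^sub>M \<mu>) (\<lambda>z. mean_wave u N (fst z - snd z))) \<longlonglongrightarrow> 0 powr (1 / q)"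
    unfolding Lp_norm_def using q by (intro tendsto_powr') auto
  then show ?thesis
    using q by simp
qed

lemma integral_tensor:
  fixes f g :: "'a \<Rightarrow> complex"
  assumes "sigma_finite_measure M" and f: "integrable M f" and g: "integrable M g"
  shows "integrable (M \<Otimes>\<^sub>M M) (\<lambda>z. f (fst z) * g (snd z))"
    and "(\<integral>z. f (fst z) * g (snd z) \<partial>(M \<Otimes>\<^sub>M M)) = (\<integral>x. f x \<partial>M) * (\<integral>y. g y \<partial>M)"
proof -
  interpret sigma_finite_measure M by fact
  interpret P: pair_sigma_finite M M ..
  have [measurable]: "f \<in> borel_measurable M" "g \<in> borel_measurable M"
    using f g by auto
  show int: "integrable (M \<Otimes>\<^sub>M M) (\<lambda>z. f (fst z) * g (snd z))"
    by (rule P.Fubini_integrable) (use f g in \<open>auto simp: norm_mult\<close>)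
  show "(\<integral>z. f (fst z) * g (snd z) \<partial>(M \<Otimes>\<^sub>M M)) = (\<integral>x. f x \<partial>M) * (\<integral>y. g y \<partial>M)"
    using P.integral_fst'[OF int] by simp
qed

text \<open>
  Here \<open>\<bar>fourier \<mu> f t\<bar>\<^sup>2\<close> is a double integral with kernel \<open>wave t (x - y)\<close>, so averaging over
  \<open>t\<close> only affects this kernel.  The function \<open>(x,y) \<mapsto> f(x) cnj(f(y))\<close> has norm
  \<open>\<parallel>f\<parallel>\<^sub>p\<^sup>2\<close> on the product space, and Hoelder's inequality there separates \<open>f\<close> from the kernel.
\<close>

lemma mean_square_fourier_le:
  fixes \<mu> :: "(real^'d) measure"
  assumes "prob_space \<mu>" and [measurable_cong]: "sets \<mu> = sets borel"
    and p: "1 < p" and q: "1 < q" and pq: "1 / p + 1 / q = 1" and f: "f \<in> Lp_space p \<mu>"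
  shows "(\<Sum>k<N. (cmod (fourier \<mu> f (real k *\<^sub>R u)))\<^sup>2) / real N
    \<le> (Lp_norm p \<mu> f)\<^sup>2 * Lp_norm q (\<mu> \<Otimes>\<^sub>M \<mu>) (\<lambda>z. mean_wave u N (fst z - snd z))"
proof -
  interpret prob_space \<mu> by fact
  interpret P: pair_prob_space \<mu> \<mu> ..
  have [measurable]: "f \<in> borel_measurable \<mu>" and fp: "integrable \<mu> (\<lambda>x. cmod (f x) powr p)"
    using f by (auto simp: Lp_space_def)
  have fi: "integrable \<mu> f"
    using Lp_space_integrable[OF _ _ f] p by (simp add: finite_measure_axioms)
  have [measurable]: "wave t \<in> borel_measurable \<mu>" for t
    by measurable
  define F where "F z = f (fst z) * cnj (f (snd z))" for z
  define K where "K z = mean_wave u N (fst z - snd z)" for z :: "(real^'d) \<times> (real^'d)"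
  have Fp: "integrable (\<mu> \<Otimes>\<^sub>M \<mu>) (\<lambda>z. cmod (F z) powr p)"
    and Fn: "(\<integral>z. cmod (F z) powr p \<partial>(\<mu> \<Otimes>\<^sub>M \<mu>)) = (\<integral>x. cmod (f x) powr p \<partial>\<mu>)\<^sup>2"
  proof -
    have eq: "cmod (F z) powr p = Re (of_real (cmod (f (fst z)) powr p) * of_real (cmod (f (snd z)) powr p))" for z
      by (simp add: F_def norm_mult powr_mult)
    have i: "integrable \<mu> (\<lambda>x. complex_of_real (cmod (f x) powr p))"
      using fp by simp
    note T = integral_tensor[OF sigma_finite_measure_axioms i i]
    show "integrable (\<mu> \<Otimes>\<^sub>M \<mu>) (\<lambda>z. cmod (F z) powr p)"
      unfolding eq using T(1) by (rule integrable_Re)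
    show "(\<integral>z. cmod (F z) powr p \<partial>(\<mu> \<Otimes>\<^sub>M \<mu>)) = (\<integral>x. cmod (f x) powr p \<partial>\<mu>)\<^sup>2"
      unfolding eq integral_Re[OF T(1)] T(2) by (simp add: power2_eq_square)
  qed
  have FL: "F \<in> Lp_space p (\<mu> \<Otimes>\<^sub>M \<mu>)"
  proof -
    have [measurable]: "(\<lambda>x. cnj (f x)) \<in> borel_measurable \<mu>"
      using fi by (intro borel_measurable_integrable) simp
    have "F \<in> borel_measurable (\<mu> \<Otimes>\<^sub>M \<mu>)"
      unfolding F_def[abs_def] by measurable
    with Fp show ?thesis
      by (simp add: Lp_space_def)
  qed
  have F_norm: "Lp_norm p (\<mu> \<Otimes>\<^sub>M \<mu>) F = (Lp_norm p \<mu> f)\<^sup>2"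
    by (simp add: Lp_norm_def Fn power2_eq_square powr_mult)
  have [measurable]: "K \<in> borel_measurable (\<mu> \<Otimes>\<^sub>M \<mu>)"
    unfolding K_def by measurable
  have KL: "K \<in> Lp_space q (\<mu> \<Otimes>\<^sub>M \<mu>)"
    unfolding Lp_space_def using q
    by (auto intro!: P.integrable_const_bound[where B = 1] AE_I2 powr_le1 simp: K_def norm_mean_wave_le)
  have wave_i: "integrable \<mu> (\<lambda>x. f x * wave t x)" for t
    by (rule Bochner_Integration.integrable_bound[OF fi]) (auto simp: norm_mult)
  have FK: "F z * K z = (\<Sum>k<N. (f (fst z) * wave (real k *\<^sub>R u) (fst z))
      * cnj (f (snd z) * wave (real k *\<^sub>R u) (snd z))) / of_nat N" for z
  proof -
    have "wave t (x - y) = wave t x * cnj (wave t y)" for t x y :: "real^'d"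
      by (simp add: wave_cis cis_cnj cis_mult algebra_simps)
    then show ?thesis
      by (simp add: F_def K_def mean_wave_def sum_distrib_left mult_ac)
  qed
  have cnj_i: "integrable \<mu> (\<lambda>x. cnj (f x * wave t x))" for t
    using wave_i[of t] integrable_cnj by blast
  note T = integral_tensor[OF sigma_finite_measure_axioms wave_i cnj_i]
  have "(\<integral>z. F z * K z \<partial>(\<mu> \<Otimes>\<^sub>M \<mu>))
      = (\<Sum>k<N. fourier \<mu> f (real k *\<^sub>R u) * cnj (fourier \<mu> f (real k *\<^sub>R u))) / of_nat N"
    unfolding FK fourier_wave using T by (simp del: complex_cnj_mult)
  also have "\<dots> = of_real ((\<Sum>k<N. (cmod (fourier \<mu> f (real k *\<^sub>R u)))\<^sup>2) / real N)"
    by (simp add: complex_norm_square flip: of_real_power)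
  finally have "(\<Sum>k<N. (cmod (fourier \<mu> f (real k *\<^sub>R u)))\<^sup>2) / real N
      = cmod (\<integral>z. F z * K z \<partial>(\<mu> \<Otimes>\<^sub>M \<mu>))"
    by (simp only: norm_of_real) (simp add: sum_nonneg)
  also have "\<dots> \<le> (Lp_norm p \<mu> f)\<^sup>2 * Lp_norm q (\<mu> \<Otimes>\<^sub>M \<mu>) K"
    using Hoelder_inequality(2)[OF p q pq FL KL] by (simp add: F_norm)
  finally show ?thesis
    by (simp add: K_def[abs_def])
qed

text \<open>
  Since \<open>p \<le> 2\<close> means \<open>q \<ge> 2\<close>, each \<open>q\<close>-th power splits off a square, and the remaining factor
  is at most \<open>\<parallel>f\<parallel>\<^sub>p\<close> to the power \<open>q - 2\<close>.
\<close>

lemma mean_fourier_powr_le: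
  fixes \<mu> :: "(real^'d) measure"
  assumes "prob_space \<mu>" and "sets \<mu> = sets borel"
    and p: "1 < p" "p \<le> 2" and q: "1 < q" and pq: "1 / p + 1 / q = 1" and f: "f \<in> Lp_space p \<mu>"
  shows "(\<Sum>k<N. cmod (fourier \<mu> f (real k *\<^sub>R u)) powr q) / real N
    \<le> Lp_norm p \<mu> f powr q * Lp_norm q (\<mu> \<Otimes>\<^sub>M \<mu>) (\<lambda>z. mean_wave u N (fst z - snd z))"
    (is "_ \<le> _ * ?\<kappa>")
proof -
  have "1 / 2 \<le> 1 / p"
    using p by (intro divide_left_mono) auto
  then have "1 / q \<le> 1 / 2"
    using pq by linarith
  then have q2: "2 \<le> q"
    using q by (simp add: field_simps)
  have split: "a powr q = a powr (q - 2) * a\<^sup>2" if "0 \<le> a" for a :: real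
  proof (cases "a = 0")
    case False
    with that have "0 < a" by simp
    moreover have "a powr q = a powr (q - 2) * a powr 2"
      by (simp flip: powr_add)
    ultimately show ?thesis
      by simp
  qed (use q in simp)
  have "cmod (fourier \<mu> f t) powr q \<le> Lp_norm p \<mu> f powr (q - 2) * (cmod (fourier \<mu> f t))\<^sup>2" for t
    unfolding split[OF norm_ge_zero] using q2 fourier_le_Lp[OF assms(1,2) p(1) q pq f, of t]
    by (intro mult_right_mono powr_mono2) auto
  then have "(\<Sum>k<N. cmod (fourier \<mu> f (real k *\<^sub>R u)) powr q) / real N
      \<le> (\<Sum>k<N. Lp_norm p \<mu> f powr (q - 2) * (cmod (fourier \<mu> f (real k *\<^sub>R u)))\<^sup>2) / real N"
    by (intro divide_right_mono sum_mono) auto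
  also have "\<dots> = Lp_norm p \<mu> f powr (q - 2) * ((\<Sum>k<N. (cmod (fourier \<mu> f (real k *\<^sub>R u)))\<^sup>2) / real N)"
    by (simp add: sum_distrib_left)
  also have "\<dots> \<le> Lp_norm p \<mu> f powr (q - 2) * ((Lp_norm p \<mu> f)\<^sup>2 * ?\<kappa>)"
    by (intro mult_left_mono mean_square_fourier_le[OF assms(1,2) p(1) q pq f]) auto
  also have "\<dots> = Lp_norm p \<mu> f powr q * ?\<kappa>"
    by (simp add: split)
  finally show ?thesis .
qed

section \<open>Divergent weights and discrete measures\<close>

text \<open>
  The weights are \<open>c k = (\<Sum>m. [k < r m] / r m)\<close>: the sum over \<open>m\<close> of the uniform distributions on
  the first \<open>r m\<close> indices.  Summing \<open>a\<close> against \<open>c\<close> therefore means adding up the averages of \<open>a\<close>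
  over these initial segments, and \<open>r\<close> is chosen so sparse that they are at most \<open>M / 2 ^ m\<close>.
  The weights do not depend on \<open>a\<close>, so that one measure serves all functions \<open>f\<close>.
\<close>

lemma divergent_weights:
  fixes \<epsilon> :: "nat \<Rightarrow> real"
  assumes "\<epsilon> \<longlonglongrightarrow> 0"
  shows "\<exists>c :: nat \<Rightarrow> real. (\<forall>k. 0 < c k) \<and> (\<integral>\<^sup>+k. ennreal (c k) \<partial>count_space UNIV) = \<infinity> \<and>
    (\<forall>a M. (\<forall>k. 0 \<le> a k) \<longrightarrow> 0 \<le> M \<longrightarrow> (\<forall>N. (\<Sum>k<N. a k) / real N \<le> M * \<epsilon> N) \<longrightarrow>
      (\<integral>\<^sup>+k. ennreal (c k) * ennreal (a k) \<partial>count_space UNIV) \<le> ennreal (2 * M))"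
proof -
  \<comment> \<open>The lower bound \<open>2 ^ m\<close> makes each \<open>c k\<close> finite, being at most \<open>\<Sum>m. 1 / 2 ^ m\<close>, and
    positive, since the segment of index \<open>m = k\<close> contains \<open>k\<close>.\<close>
  have "\<exists>N. 2 ^ m \<le> N \<and> \<epsilon> N \<le> (1 / 2) ^ m" for m :: nat
  proof -
    have "eventually (\<lambda>N. \<epsilon> N < (1 / 2) ^ m) sequentially"
      using assms by (rule order_tendstoD) simp
    moreover have "eventually (\<lambda>N. 2 ^ m \<le> N) sequentially"
      by (rule eventually_ge_at_top)
    ultimately have "eventually (\<lambda>N. 2 ^ m \<le> N \<and> \<epsilon> N \<le> (1 / 2) ^ m) sequentially"
      by eventually_elim auto
    then show ?thesis
      by (auto simp: eventually_sequentially)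
  qed
  then obtain r :: "nat \<Rightarrow> nat" where r: "\<And>m. 2 ^ m \<le> r m" "\<And>m. \<epsilon> (r m) \<le> (1 / 2) ^ m"
    by metis
  have r_pos: "0 < r m" for m
    using r(1)[of m] by (intro less_le_trans[of 0 "2 ^ m" "r m"]) auto
  define w where "w m k = (if k < r m then 1 / real (r m) else 0)" for m k
  define c where "c k = (\<Sum>m. w m k)" for k
  have w_nonneg: "0 \<le> w m k" for m k
    by (simp add: w_def)
  have geo: "summable (\<lambda>m. (1 / 2 :: real) ^ m)"
    by (simp add: summable_geometric)
  have w_summable: "summable (\<lambda>m. w m k)" for k
  proof (rule summable_comparison_test'[OF geo])
    fix m
    have "1 / real (r m) \<le> 1 / 2 ^ m"
      using of_nat_mono[OF r(1)[of m], where 'a = real] r_pos[of m]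
      by (intro divide_left_mono) auto
    then show "norm (w m k) \<le> (1 / 2) ^ m"
      by (simp add: w_def power_one_over)
  qed
  have c_pos: "0 < c k" for k
  proof -
    have "k < r k"
      using r(1)[of k] less_exp[of k] by linarith
    then have "0 < w k k"
      by (simp add: w_def)
    then show ?thesis
      unfolding c_def by (intro suminf_pos2[OF w_summable w_nonneg])
  qed
  have sum_c: "(\<integral>\<^sup>+k. ennreal (c k) * ennreal (a k) \<partial>count_space UNIV)
      = (\<Sum>m. ennreal ((\<Sum>k<r m. a k) / real (r m)))" if a: "\<And>k. 0 \<le> a k" for a
  proof -
    have "(\<integral>\<^sup>+k. ennreal (c k) * ennreal (a k) \<partial>count_space UNIV)
        = (\<integral>\<^sup>+k. (\<Sum>m. ennreal (w m k * a k)) \<partial>count_space UNIV)"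
    proof (rule nn_integral_cong)
      fix k
      have "ennreal (c k) * ennreal (a k) = ennreal (\<Sum>m. w m k * a k)"
        using c_pos[of k] a[of k] suminf_mult2[OF w_summable[of k], of "a k"]
        by (simp add: c_def flip: ennreal_mult)
      also have "\<dots> = (\<Sum>m. ennreal (w m k * a k))"
        using w_summable a w_nonneg by (intro suminf_ennreal2[symmetric] summable_mult2) auto
      finally show "ennreal (c k) * ennreal (a k) = (\<Sum>m. ennreal (w m k * a k))" .
    qed
    also have "\<dots> = (\<Sum>m. \<integral>\<^sup>+k. ennreal (w m k * a k) \<partial>count_space UNIV)"
      by (rule nn_integral_suminf) auto
    also have "(\<lambda>m. \<integral>\<^sup>+k. ennreal (w m k * a k) \<partial>count_space UNIV)
        = (\<lambda>m. ennreal ((\<Sum>k<r m. a k) / real (r m)))"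
    proof
      fix m
      have "(\<integral>\<^sup>+k. ennreal (w m k * a k) \<partial>count_space UNIV) = (\<Sum>k<r m. ennreal (w m k * a k))"
        by (rule nn_integral_count_space') (auto simp: w_def)
      also have "\<dots> = ennreal (\<Sum>k<r m. w m k * a k)"
        by (rule sum_ennreal) (simp add: a w_nonneg)
      also have "(\<Sum>k<r m. w m k * a k) = (\<Sum>k<r m. a k) / real (r m)"
        by (simp add: w_def sum_divide_distrib)
      finally show "(\<integral>\<^sup>+k. ennreal (w m k * a k) \<partial>count_space UNIV) = ennreal ((\<Sum>k<r m. a k) / real (r m))" .
    qed
    finally show ?thesis .
  qed
  have "(\<Sum>k<r m. 1) / real (r m) = 1" for m
    using r_pos[of m] by simp
  then have "(\<integral>\<^sup>+k. ennreal (c k) * ennreal 1 \<partial>count_space UNIV) = (\<Sum>m::nat. ennreal 1)"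
    by (subst sum_c) simp_all
  also have "\<dots> = \<infinity>"
    unfolding nn_integral_count_space_nat[symmetric] by simp
  finally have total: "(\<integral>\<^sup>+k. ennreal (c k) \<partial>count_space UNIV) = \<infinity>"
    by simp
  have "(\<integral>\<^sup>+k. ennreal (c k) * ennreal (a k) \<partial>count_space UNIV) \<le> ennreal (2 * M)"
    if a: "\<And>k. 0 \<le> a k" and M: "0 \<le> M" and le: "\<And>N. (\<Sum>k<N. a k) / real N \<le> M * \<epsilon> N" for a M
  proof -
    have "(\<integral>\<^sup>+k. ennreal (c k) * ennreal (a k) \<partial>count_space UNIV)
        \<le> (\<Sum>m. ennreal (M * (1 / 2) ^ m))"
      unfolding sum_c[OF a]
      by (intro suminf_le ennreal_leI order_trans[OF le] mult_left_mono r M) auto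
    also have "\<dots> = ennreal (\<Sum>m. M * (1 / 2) ^ m)"
      using M geo by (intro suminf_ennreal2) (auto intro: summable_mult)
    also have "(\<Sum>m. M * (1 / 2 :: real) ^ m) = 2 * M"
      using geo by (simp add: suminf_mult suminf_geometric)
    finally show ?thesis .
  qed
  with c_pos total show ?thesis
    by blast
qed

definition weighted_points :: "(nat \<Rightarrow> real) \<Rightarrow> (nat \<Rightarrow> real^'d) \<Rightarrow> (real^'d) measure" where
  "weighted_points c t = distr (density (count_space UNIV) (\<lambda>k. ennreal (c k))) borel t"

lemma sets_weighted_points [simp, measurable_cong]: "sets (weighted_points c t) = sets borel"
  by (simp add: weighted_points_def)

lemma nn_integral_weighted_points:
  assumes "g \<in> borel_measurable borel"
  shows "(\<integral>\<^sup>+s. g s \<partial>weighted_points c t) = (\<integral>\<^sup>+k. ennreal (c k) * g (t k) \<partial>count_space UNIV)"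
  unfolding weighted_points_def using assms by (simp add: nn_integral_distr nn_integral_density)

lemma emeasure_weighted_points:
  assumes "A \<in> sets borel"
  shows "emeasure (weighted_points c t) A
    = (\<integral>\<^sup>+k. ennreal (c k) * indicator A (t k) \<partial>count_space UNIV)"
proof -
  have "emeasure (weighted_points c t) A = (\<integral>\<^sup>+s. indicator A s \<partial>weighted_points c t)"
    using assms by simp
  also have "\<dots> = (\<integral>\<^sup>+k. ennreal (c k) * indicator A (t k) \<partial>count_space UNIV)"
    using assms by (intro nn_integral_weighted_points) simp
  finally show ?thesis .
qed

lemma discrete_weighted_points:
  fixes t :: "nat \<Rightarrow> real^'d"
  assumes t: "inj t" and c: "\<And>k. 0 < c k"
  shows "discrete_measure (weighted_points c t)"
  unfolding discrete_measure_def
proof (intro conjI exI[of _ "range t"] exI[of _ "\<lambda>s. c (inv t s)"] ballI)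
  fix A :: "(real^'d) set" assume A: "A \<in> sets borel"
  have "(\<integral>\<^sup>+s. ennreal (c (inv t s)) * emeasure (return borel s) A \<partial>count_space (range t))
      = (\<integral>\<^sup>+k. ennreal (c (inv t (t k))) * emeasure (return borel (t k)) A \<partial>count_space UNIV)"
    using t by (intro nn_integral_bij_count_space[symmetric]) (simp add: bij_betw_def)
  then show "emeasure (weighted_points c t) A
      = (\<integral>\<^sup>+s. ennreal (c (inv t s)) * emeasure (return borel s) A \<partial>count_space (range t))"
    using A t by (simp add: emeasure_weighted_points)
qed (use c in auto)

section \<open>Infinite discrete Bessel measures\<close>

theorem atomless_infinite_discrete_bessel:
  fixes \<mu> :: "(real^'d) measure" and p q :: real
  assumes \<mu>: "prob_space \<mu>" "sets \<mu> = sets borel" and atomless: "\<And>x. emeasure \<mu> {x} = 0"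
    and p: "1 < p" "p \<le> 2" and q: "1 < q" and pq: "1 / p + 1 / q = 1"
  shows "\<exists>\<nu>. discrete_measure \<nu> \<and> emeasure \<nu> UNIV = \<infinity> \<and> bessel_measure p (ennreal q) \<mu> \<nu>"
proof -
  interpret prob_space \<mu> by fact
  interpret P: pair_prob_space \<mu> \<mu> ..
  obtain u where u: "AE z in \<mu> \<Otimes>\<^sub>M \<mu>. u \<bullet> (fst z - snd z) \<notin> \<int>"
    using exists_nonresonant_direction[OF assms(1-3)] by blast
  \<comment> \<open>For \<open>u = 0\<close> all the products \<open>u \<bullet> (x - y)\<close> would be the integer \<open>0\<close>.\<close>
  have "u \<noteq> 0"
    using u by (auto simp: P.AE_False)
  define t where "t k = real k *\<^sub>R u" for k :: nat
  have "inj t"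
    using \<open>u \<noteq> 0\<close> by (auto simp: inj_def t_def)
  define \<epsilon> where "\<epsilon> N = Lp_norm q (\<mu> \<Otimes>\<^sub>M \<mu>) (\<lambda>z. mean_wave u N (fst z - snd z))" for N
  have "\<epsilon> \<longlonglongrightarrow> 0"
    unfolding \<epsilon>_def[abs_def] using q by (intro Lp_norm_mean_wave_tendsto_0[OF \<mu> u]) auto
  then obtain c :: "nat \<Rightarrow> real" where c: "\<And>k. 0 < c k"
    "(\<integral>\<^sup>+k. ennreal (c k) \<partial>count_space UNIV) = \<infinity>"
    and cb: "\<And>a M. (\<And>k. 0 \<le> a k) \<Longrightarrow> 0 \<le> M \<Longrightarrow> (\<And>N. (\<Sum>k<N. a k) / real N \<le> M * \<epsilon> N) \<Longrightarrow>
      (\<integral>\<^sup>+k. ennreal (c k) * ennreal (a k) \<partial>count_space UNIV) \<le> ennreal (2 * M)"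
    using divergent_weights[of \<epsilon>] by metis
  define \<nu> where "\<nu> = weighted_points c t"
  have "(\<integral>\<^sup>+s. ennreal (cmod (semi_inner p \<mu> f (expo s)) powr q) \<partial>\<nu>)
      \<le> ennreal (2 * Lp_norm p \<mu> f powr q)" if f: "f \<in> Lp_space p \<mu>" for f
  proof -
    have [measurable]: "fourier \<mu> f \<in> borel_measurable borel"
      using f by (intro fourier_measurable[OF \<mu>]) (simp add: Lp_space_def)
    have "(\<integral>\<^sup>+s. ennreal (cmod (semi_inner p \<mu> f (expo s)) powr q) \<partial>\<nu>)
        = (\<integral>\<^sup>+k. ennreal (c k) * ennreal (cmod (fourier \<mu> f (t k)) powr q) \<partial>count_space UNIV)"
      unfolding \<nu>_def semi_inner_expo[OF \<mu>(1)] by (rule nn_integral_weighted_points) measurable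
    also have "\<dots> \<le> ennreal (2 * Lp_norm p \<mu> f powr q)"
      unfolding t_def \<epsilon>_def
      using mean_fourier_powr_le[OF \<mu> p q pq f, where u = u] by (intro cb) (auto simp: \<epsilon>_def)
    finally show ?thesis .
  qed
  then have "bessel_measure p (ennreal q) \<mu> \<nu>"
    unfolding bessel_measure_def using q by (auto simp: \<nu>_def intro!: exI[of _ 2])
  moreover have "discrete_measure \<nu>"
    unfolding \<nu>_def by (rule discrete_weighted_points) (fact \<open>inj t\<close>, fact c(1))
  moreover have "emeasure \<nu> UNIV = \<infinity>"
    by (simp add: \<nu>_def emeasure_weighted_points c(2))
  ultimately show ?thesis
    by blast
qed

lemma exists_infinite_discrete_measure:
  "\<exists>\<nu> :: (real^'d) measure. discrete_measure \<nu> \<and> emeasure \<nu> UNIV = \<infinity>"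
proof (intro exI conjI)
  let ?\<nu> = "weighted_points (\<lambda>_. 1) (\<lambda>k. real k *\<^sub>R (1 :: real^'d))"
  show "discrete_measure ?\<nu>"
    by (rule discrete_weighted_points) (auto simp: inj_def)
  show "emeasure ?\<nu> UNIV = \<infinity>"
    by (simp add: emeasure_weighted_points)
qed

lemma bessel_measure_1_infinity:
  fixes \<mu> \<nu> :: "(real^'d) measure"
  assumes \<mu>: "prob_space \<mu>" "sets \<mu> = sets borel" and \<nu> [measurable_cong]: "sets \<nu> = sets borel"
  shows "bessel_measure 1 \<infinity> \<mu> \<nu>"
proof -
  have "esssup \<nu> (\<lambda>t. ennreal (cmod (fourier \<mu> f t))) \<le> ennreal (1 * Lp_norm 1 \<mu> f)"
    if f: "f \<in> Lp_space 1 \<mu>" for f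
  proof (rule esssup_I)
    have [measurable]: "fourier \<mu> f \<in> borel_measurable borel"
      using f by (intro fourier_measurable[OF \<mu>]) (simp add: Lp_space_def)
    show "(\<lambda>t. ennreal (cmod (fourier \<mu> f t))) \<in> borel_measurable \<nu>"
      by measurable
    show "AE t in \<nu>. ennreal (cmod (fourier \<mu> f t)) \<le> ennreal (1 * Lp_norm 1 \<mu> f)"
      by (simp add: fourier_le_L1[OF \<mu>(1)] ennreal_leI)
  qed
  then show ?thesis
    unfolding bessel_measure_def using \<nu> by (auto intro!: exI[of _ "1::real"])
qed

lemma ennreal_conjugate_cases:
  assumes "1 \<le> p" and "1 / ennreal p + 1 / q = 1"
  obtains "p = 1" "q = \<infinity>"
  | q' where "1 < p" "1 < q'" "1 / p + 1 / q' = 1" "q = ennreal q'"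
proof (cases q)
  case top
  with assms have "ennreal (1 / p) = ennreal 1"
    using divide_ennreal[of 1 p] by simp
  with assms have "p = 1"
    by (subst (asm) ennreal_inj) auto
  with top that show thesis by simp
next
  case (real q')
  have "q' \<noteq> 0"
    using assms real by auto
  with real have pos: "0 < q'" by simp
  have "ennreal (1 / p + 1 / q') = ennreal 1"
    using assms pos real divide_ennreal[of 1 p] divide_ennreal[of 1 q'] ennreal_plus[of "1 / p" "1 / q'"]
    by simp
  then have sum: "1 / p + 1 / q' = 1"
    using assms pos by (subst (asm) ennreal_inj) auto
  have "1 < p"
    using sum pos assms by (cases "p = 1") auto
  moreover have "1 < q'"
  proof -
    have "1 / q' < 1" using sum \<open>1 < p\<close> by (smt (verit) divide_pos_pos)
    then show ?thesis using pos by (simp add: field_simps)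
  qed
  ultimately show thesis
    using that sum real by blast
qed

theorem theorem3p24:
  fixes \<mu> :: "(real^'d) measure"
    and \<tau> :: "nat \<Rightarrow> real^'d \<Rightarrow> real^'d"
    and \<rho> :: "nat \<Rightarrow> real"
    and n :: nat
    and p :: real
    and q :: ennreal
  assumes "affine_ifs n \<tau>"
    and "probability_weights n \<rho>"
    and "fractal_measure n \<tau> \<rho> \<mu>"
    and "1 \<le> p" and "p \<le> 2"
    and "1 / ennreal p + 1 / q = 1"
  shows "\<exists>\<nu> :: (real^'d) measure.
           discrete_measure \<nu> \<and> emeasure \<nu> UNIV = \<infinity> \<and> bessel_measure p q \<mu> \<nu>"
proof -
  have \<mu>: "prob_space \<mu>" "sets \<mu> = sets borel" and atomless: "\<And>x. emeasure \<mu> {x} = 0"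
    using assms(3) by (auto simp: fractal_measure_def invariant_measure_def)
  from assms(4,6) show ?thesis
  proof (cases rule: ennreal_conjugate_cases)
    case 1
    obtain \<nu> :: "(real^'d) measure" where \<nu>: "discrete_measure \<nu>" "emeasure \<nu> UNIV = \<infinity>"
      using exists_infinite_discrete_measure by blast
    then have "bessel_measure 1 \<infinity> \<mu> \<nu>"
      by (intro bessel_measure_1_infinity[OF \<mu>]) (simp add: discrete_measure_def)
    with \<nu> 1 show ?thesis by blast
  next
    case (2 q')
    with atomless_infinite_discrete_bessel[OF \<mu> atomless, of p q'] assms(5) show ?thesis
      by blast
  qed
qed

end
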